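(* Let $M=(E,\rho)$ be a matroid and let $F\subseteq 1_{\mathcal{Z}}$ be a flat with $\rho(F)=\rho(1_{\mathcal{Z}})-2$. Then $$|(F,1_{\mathcal{Z}})_{\mathcal{F}}|=|1_{\mathcal{Z}}-F|-\sum_{Z\in\bar{\Upsilon}(F)}(|Z-F|-1).$$
   Context: A matroid $M=(E,\rho)$ is given by its rank function; closure $\mathrm{cl}(X)=\{e:\rho(X\cup e)=\rho(X)\}$, cyclic operator $\mathrm{cyc}(X)=\{e\in X:\rho(X-e)=\rho(X)\}$. Flats are sets with $\mathrm{cl}(X)=X$; $\mathcal{F}(M)$ is the lattice of flats. Cyclic flats are flats with $\mathrm{cyc}(X)=X$; $\mathcal{Z}(M)$ is the lattice of cyclic flats and $1_{\mathcal{Z}}=\mathrm{cyc}(E)$ its top element. $(F,1_{\mathcal{Z}})_{\mathcal{F}}$ denotes the set of flats $H$ of $M$ with $F\subsetneq H\subsetneq 1_{\mathcal{Z}}$. For a flat $F$ with $\rho(F)=\rho(1_{\mathcal{Z}})-2$, $\Upsilon(F)=\{X\in\mathcal{Z}(M):\rho(1_{\mathcal{Z}})-1=\rho(X)+|F-X|\}$ and $\bar{\Upsilon}(F)$ is the set of inclusion-maximal elements of $\Upsilon(F)$.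
   Formalization: The summand |Z−F|−1 is replaced by max(0, |Z−F|−1), so a Z contained in F contributes 0 rather than −1; with −1 the formula fails, e.g. for U_{3,4} on {a,b,c,d} with a' added parallel to a and F={a,a'} (3 flats, formula gives 4). *)

theory Defs
  imports Main
begin

locale matroid =
  fixes E :: "'a set" and r :: "'a set \<Rightarrow> nat"
  assumes finite_ground: "finite E"
    and rank_le_card: "X \<subseteq> E \<Longrightarrow> r X \<le> card X"
    and rank_mono: "X \<subseteq> Y \<Longrightarrow> Y \<subseteq> E \<Longrightarrow> r X \<le> r Y"
    and rank_submodular:
      "X \<subseteq> E \<Longrightarrow> Y \<subseteq> E \<Longrightarrow> r (X \<union> Y) + r (X \<inter> Y) \<le> r X + r Y"

definition cl :: "'a set \<Rightarrow> ('a set \<Rightarrow> nat) \<Rightarrow> 'a set \<Rightarrow> 'a set" where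
  "cl E r X = {e \<in> E. r (insert e X) = r X}"

definition cyc :: "('a set \<Rightarrow> nat) \<Rightarrow> 'a set \<Rightarrow> 'a set" where
  "cyc r X = {e \<in> X. r (X - {e}) = r X}"

definition flats :: "'a set \<Rightarrow> ('a set \<Rightarrow> nat) \<Rightarrow> 'a set set" where
  "flats E r = {X. X \<subseteq> E \<and> cl E r X = X}"

definition cyclic_flats :: "'a set \<Rightarrow> ('a set \<Rightarrow> nat) \<Rightarrow> 'a set set" where
  "cyclic_flats E r = {X \<in> flats E r. cyc r X = X}"

definition top_cyclic_flat :: "'a set \<Rightarrow> ('a set \<Rightarrow> nat) \<Rightarrow> 'a set" where
  "top_cyclic_flat E r = cyc r E"

definition open_flat_interval ::
    "'a set \<Rightarrow> ('a set \<Rightarrow> nat) \<Rightarrow> 'a set \<Rightarrow> 'a set \<Rightarrow> 'a set set" where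
  "open_flat_interval E r F G = {H \<in> flats E r. F \<subset> H \<and> H \<subset> G}"

definition Upsilon :: "'a set \<Rightarrow> ('a set \<Rightarrow> nat) \<Rightarrow> 'a set \<Rightarrow> 'a set set" where
  "Upsilon E r F =
     {X \<in> cyclic_flats E r.
        int (r (top_cyclic_flat E r)) - 1 = int (r X) + int (card (F - X))}"

definition Upsilon_max :: "'a set \<Rightarrow> ('a set \<Rightarrow> nat) \<Rightarrow> 'a set \<Rightarrow> 'a set set" where
  "Upsilon_max E r F = {X \<in> Upsilon E r F. \<forall>Y\<in>Upsilon E r F. X \<subseteq> Y \<longrightarrow> Y = X}"

(* |Z - F| - 1 with the convention that the empty set has excess 0, not -1.
   Upsilon_max E r F may contain some Z \<subseteq> F. With the summand -1 for such Z the flat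
   count fails: in the rank-3 matroid obtained from U_{3,4} on {a,b,c,d} by adding a'
   parallel to a, the flat F = {a,a'} has Upsilon_max E r F = {{}}, and exactly
   |E - F| = 3 flats lie strictly between F and E, whereas 3 - (0 - 1) = 4. *)
definition excess :: "'a set \<Rightarrow> 'a set \<Rightarrow> int" where
  "excess Z F = max 0 (int (card (Z - F)) - 1)"

end

(* The flats strictly between F and the top cyclic flat T are the hyperplanes H of M|T that
   contain F, and the sets H - F partition T - F.  Hence their number is |T - F| minus the sum
   of |H - F| - 1.  If |H - F| >= 2, then no element of H - F is a coloop of H, so Z = cyc H
   satisfies Z - F = H - F, and H |-> cyc H is a bijection from these H onto the members Z of
   Upsilon_max with |Z - F| >= 2; its inverse is Z |-> cl (Z Un F).  All the other terms of
   both sums vanish. *)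
theory Submission
  imports Defs
begin

context matroid
begin

section \<open>Rank, closure and flats\<close>

lemma rank_insert_le:
  assumes "X \<subseteq> E" "e \<in> E"
  shows "r (insert e X) \<le> r X + 1"
  using rank_submodular[of "{e}" X] rank_le_card[of "{e}"] assms by simp

lemma rank_union_le:
  assumes "X \<subseteq> E" "Y \<subseteq> E"
  shows "r (X \<union> Y) \<le> r X + card (Y - X)"
proof -
  have "r (X \<union> (Y - X)) + r (X \<inter> (Y - X)) \<le> r X + r (Y - X)"
    using assms by (intro rank_submodular) auto
  moreover have "r (Y - X) \<le> card (Y - X)"
    using assms by (intro rank_le_card) auto
  ultimately show ?thesis by simp
qed

text \<open>Diminishing returns: submodularity for \<open>insert e X\<close> and \<open>Y\<close>,
  whose intersection contains \<open>X\<close>, bounds the gain of \<open>e\<close> over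
  \<open>Y\<close> by its gain over \<open>X\<close>.\<close>

lemma rank_insert_eq_mono:
  assumes "X \<subseteq> Y" "Y \<subseteq> E" "e \<in> E" "r (insert e X) = r X"
  shows "r (insert e Y) = r Y"
proof -
  have "r (insert e X \<union> Y) + r (insert e X \<inter> Y) \<le> r (insert e X) + r Y"
    using assms by (intro rank_submodular) auto
  moreover have "r X \<le> r (insert e X \<inter> Y)"
    using assms by (intro rank_mono) auto
  moreover have "r Y \<le> r (insert e Y)"
    using assms by (intro rank_mono) auto
  moreover have "insert e X \<union> Y = insert e Y"
    using assms by auto
  ultimately show ?thesis using assms by simp
qed

lemma cl_subset: "cl E r X \<subseteq> E"
  by (auto simp: cl_def)

lemma subset_cl: "X \<subseteq> E \<Longrightarrow> X \<subseteq> cl E r X"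
  by (auto simp: cl_def insert_absorb)

lemma cl_mono: "X \<subseteq> Y \<Longrightarrow> Y \<subseteq> E \<Longrightarrow> cl E r X \<subseteq> cl E r Y"
  unfolding cl_def using rank_insert_eq_mono by blast

text \<open>The elements of the closure are added to \<open>X\<close> one at a time; each adds
  nothing to \<open>X\<close>, hence nothing to the larger set reached so far.\<close>

lemma rank_cl:
  assumes "X \<subseteq> E"
  shows "r (cl E r X) = r X"
proof -
  have "r (X \<union> A) = r X" if "finite A" "A \<subseteq> cl E r X" for A
    using that
  proof (induction A rule: finite_induct)
    case (insert a A)
    have "r (insert a (X \<union> A)) = r (X \<union> A)"
      by (rule rank_insert_eq_mono[of X]) (use insert.prems assms in \<open>auto simp: cl_def\<close>)
    then show ?case using insert by simp
  qed simp
  moreover have "finite (cl E r X)"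
    using cl_subset finite_ground finite_subset by blast
  moreover have "X \<union> cl E r X = cl E r X"
    using subset_cl[OF assms] by auto
  ultimately show ?thesis by fastforce
qed

text \<open>If \<open>e\<close> does not raise the rank of the closure, then
  \<open>r (insert e X)\<close> is squeezed between \<open>r X\<close> and the rank of the closure,
  which is again \<open>r X\<close>.\<close>

lemma cl_flat:
  assumes "X \<subseteq> E"
  shows "cl E r X \<in> flats E r"
proof -
  have "e \<in> cl E r X" if "e \<in> E" "r (insert e (cl E r X)) = r (cl E r X)" for e
  proof -
    have "r (insert e X) \<le> r (insert e (cl E r X))"
      using that subset_cl[OF assms] cl_subset by (intro rank_mono) auto
    moreover have "r X \<le> r (insert e X)"
      using that assms by (intro rank_mono) auto
    ultimately show ?thesis
      using that rank_cl[OF assms] by (simp add: cl_def)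
  qed
  then have "cl E r (cl E r X) \<subseteq> cl E r X"
    by (auto simp: cl_def[of E r "cl E r X"])
  then show ?thesis
    using subset_cl[OF cl_subset] cl_subset by (auto simp: flats_def)
qed

lemma cl_subset_flat: "X \<subseteq> G \<Longrightarrow> G \<in> flats E r \<Longrightarrow> cl E r X \<subseteq> G"
  using cl_mono[of X G] by (simp add: flats_def)

text \<open>By the definition of closure, any element outside \<open>G\<close> raises its rank.
  \<open>X\<close> is an arbitrary set here, so that \<open>F\<close> can be compared with
  \<open>insert e F\<close> and \<open>Z \<union> F\<close>.\<close>

lemma flat_rank_less:
  assumes "G \<in> flats E r" "G \<subset> X" "X \<subseteq> E"
  shows "r G < r X"
proof -
  obtain e where e: "e \<in> X" "e \<notin> G" using assms by auto
  have "r (insert e G) \<noteq> r G"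
    using assms e by (auto simp: flats_def cl_def)
  moreover have "r G \<le> r (insert e G)" "r (insert e G) \<le> r X"
    using assms e by (intro rank_mono; blast)+
  ultimately show ?thesis by linarith
qed

section \<open>The cyclic operator and coloops\<close>

lemma cyc_subset: "cyc r X \<subseteq> X"
  by (auto simp: cyc_def)

text \<open>Membership of \<open>e\<close> in \<open>cyc r X\<close> means that \<open>e\<close>
  adds no rank to \<open>X - {e}\<close>; then it adds none to \<open>Y - {e}\<close>
  either.\<close>

lemma cyc_mono:
  assumes "X \<subseteq> Y" "Y \<subseteq> E"
  shows "cyc r X \<subseteq> cyc r Y"
proof
  fix e assume e: "e \<in> cyc r X"
  have "r (insert e (Y - {e})) = r (Y - {e})"
    by (rule rank_insert_eq_mono[of "X - {e}"])
       (use e assms in \<open>auto simp: cyc_def insert_absorb\<close>)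
  then show "e \<in> cyc r Y"
    using e assms by (auto simp: cyc_def insert_absorb)
qed

text \<open>The elements of \<open>X - cyc r X\<close> are the coloops of the restriction to
  \<open>X\<close>. If \<open>e\<close> added nothing to \<open>A\<close>, it would add nothing to
  \<open>X - {e}\<close>.\<close>

lemma rank_insert_coloop:
  assumes "X \<subseteq> E" "e \<in> X - cyc r X" "A \<subseteq> X - {e}"
  shows "r (insert e A) = r A + 1"
proof -
  have e: "e \<in> X" "e \<notin> cyc r X" "e \<in> E" "insert e X = X" "A \<subseteq> E" using assms by auto
  have "r (insert e A) \<noteq> r A"
  proof
    assume "r (insert e A) = r A"
    with assms e(3) have "r (insert e (X - {e})) = r (X - {e})"
      by (intro rank_insert_eq_mono[of A "X - {e}"]) auto
    then show False
      using e by (simp add: cyc_def)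
  qed
  moreover have "r A \<le> r (insert e A)"
    using e by (intro rank_mono) auto
  moreover have "r (insert e A) \<le> r A + 1"
    using e by (intro rank_insert_le)
  ultimately show ?thesis by linarith
qed

text \<open>Coloops added one by one each raise the rank by 1. With \<open>A = cyc r X\<close> and
  \<open>C = X - cyc r X\<close> this splits \<open>r X\<close> into the rank of the cyclic part and
  the number of coloops.\<close>

lemma rank_union_coloops:
  assumes "X \<subseteq> E" "C \<subseteq> X - cyc r X" "A \<subseteq> X - C"
  shows "r (A \<union> C) = r A + card C"
proof -
  have "finite C"
    using assms by (intro finite_subset[OF _ finite_ground]) auto
  then show ?thesis using assms(2,3)
  proof (induction C rule: finite_induct)
    case (insert c C)
    have "r (insert c (A \<union> C)) = r (A \<union> C) + 1"
      using insert by (intro rank_insert_coloop[OF assms(1)]) auto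
    moreover have "r (A \<union> C) = r A + card C"
      using insert by (intro insert.IH) auto
    ultimately show ?case using insert by simp
  qed simp
qed

text \<open>The closure of \<open>cyc r H\<close> stays inside the flat \<open>H\<close>, and a
  coloop of \<open>H\<close> raises the rank of \<open>cyc r H\<close>, so it is not in that
  closure.\<close>

lemma cyc_flat:
  assumes "H \<in> flats E r"
  shows "cyc r H \<in> flats E r"
proof -
  have H: "H \<subseteq> E" using assms by (simp add: flats_def)
  have "cl E r (cyc r H) \<subseteq> H"
    using cl_subset_flat[OF cyc_subset assms] .
  moreover have "e \<notin> cl E r (cyc r H)" if "e \<in> H - cyc r H" for e
  proof -
    have "cyc r H \<subseteq> H - {e}" using that cyc_subset[of H] by blast
    then show ?thesis using rank_insert_coloop[OF H that] by (simp add: cl_def)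
  qed
  ultimately have "cl E r (cyc r H) \<subseteq> cyc r H" by blast
  then show ?thesis
    using subset_cl[of "cyc r H"] H cyc_subset[of H] by (auto simp: flats_def)
qed

text \<open>Putting the coloops of \<open>H\<close> back adds the same amount to the ranks of
  \<open>cyc r H - {e}\<close> and \<open>cyc r H\<close>. The results \<open>r (H - {e})\<close>
  and \<open>r H\<close> agree, so the original ranks agree too.\<close>

lemma cyc_idem:
  assumes "H \<subseteq> E"
  shows "cyc r (cyc r H) = cyc r H"
proof
  show "cyc r H \<subseteq> cyc r (cyc r H)"
  proof
    fix e assume e: "e \<in> cyc r H"
    let ?C = "H - cyc r H"
    have "r ((cyc r H - {e}) \<union> ?C) = r (cyc r H - {e}) + card ?C"
      using cyc_subset[of H] by (intro rank_union_coloops[OF assms]) auto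
    moreover have "r (cyc r H \<union> ?C) = r (cyc r H) + card ?C"
      using cyc_subset[of H] by (intro rank_union_coloops[OF assms]) auto
    moreover have "(cyc r H - {e}) \<union> ?C = H - {e}" "cyc r H \<union> ?C = H"
      using e cyc_subset[of H] by auto
    moreover have "r (H - {e}) = r H" using e by (simp add: cyc_def)
    ultimately show "e \<in> cyc r (cyc r H)" using e by (simp add: cyc_def[of r "cyc r H"])
  qed
qed (rule cyc_subset)

lemma cyc_cyclic_flat: "H \<in> flats E r \<Longrightarrow> cyc r H \<in> cyclic_flats E r"
  using cyc_flat[of H] cyc_idem[of H] by (simp add: cyclic_flats_def flats_def)

lemma top_cyclic_flat_flat: "top_cyclic_flat E r \<in> flats E r"
  unfolding top_cyclic_flat_def
  by (rule cyc_flat) (auto simp: flats_def cl_def insert_absorb)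

lemma cyclic_flat_subset_top: "Z \<in> cyclic_flats E r \<Longrightarrow> Z \<subseteq> top_cyclic_flat E r"
  using cyc_mono[of Z E] by (simp add: cyclic_flats_def flats_def top_cyclic_flat_def)

end

section \<open>Flats strictly between \<open>F\<close> and the top cyclic flat\<close>

locale corank_two_flat = matroid +
  fixes F :: "'a set"
  assumes flat: "F \<in> flats E r"
    and subset_top: "F \<subseteq> top_cyclic_flat E r"
    and rank_top: "r (top_cyclic_flat E r) = r F + 2"
begin

abbreviation T :: "'a set" where "T \<equiv> top_cyclic_flat E r"
abbreviation \<I> :: "'a set set" where "\<I> \<equiv> open_flat_interval E r F T"

lemma top_subset: "T \<subseteq> E"
  using top_cyclic_flat_flat by (simp add: flats_def)

text \<open>Rank is strictly monotone on flats and \<open>T\<close> is two ranks above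
  \<open>F\<close>, which leaves a single value for \<open>r H\<close>.\<close>

lemma intervalD:
  assumes "H \<in> \<I>"
  shows "H \<in> flats E r" "H \<subseteq> E" "F \<subset> H" "H \<subset> T" "r H = r F + 1"
proof -
  show H: "H \<in> flats E r" "F \<subset> H" "H \<subset> T"
    using assms by (auto simp: open_flat_interval_def)
  then show "H \<subseteq> E" by (simp add: flats_def)
  then have "r F < r H" "r H < r T"
    using H flat top_subset by (auto intro!: flat_rank_less)
  then show "r H = r F + 1" using rank_top by simp
qed

lemma flat_in_interval:
  assumes "H \<in> flats E r" "F \<subseteq> H" "H \<subseteq> T" "r H = r F + 1"
  shows "H \<in> \<I>"
  using assms rank_top by (auto simp: open_flat_interval_def)

lemma interval_subset_eq:
  assumes "H \<in> \<I>" "G \<in> \<I>" "H \<subseteq> G"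
  shows "H = G"
  using flat_rank_less[of H G] intervalD[OF assms(1)] intervalD[OF assms(2)] assms(3) by auto

lemma cl_insert_in_interval:
  assumes "e \<in> T - F"
  shows "cl E r (insert e F) \<in> \<I>"
proof (rule flat_in_interval)
  have eF: "insert e F \<subseteq> E" using assms subset_top top_subset by auto
  show "cl E r (insert e F) \<in> flats E r" using cl_flat[OF eF] .
  show "F \<subseteq> cl E r (insert e F)" using subset_cl[OF eF] by auto
  show "cl E r (insert e F) \<subseteq> T"
    using assms subset_top by (intro cl_subset_flat top_cyclic_flat_flat) auto
  have "r F < r (insert e F)" using assms eF by (intro flat_rank_less flat) auto
  moreover have "r (insert e F) \<le> r F + 1" using eF by (intro rank_insert_le) auto
  ultimately show "r (cl E r (insert e F)) = r F + 1" using rank_cl[OF eF] by simp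
qed

text \<open>An element outside \<open>F\<close> determines the member of the interval that contains
  it; this makes the sets \<open>H - F\<close> pairwise disjoint.\<close>

lemma interval_eq_cl_insert:
  assumes "H \<in> \<I>" "e \<in> H - F"
  shows "H = cl E r (insert e F)"
proof -
  have "cl E r (insert e F) \<subseteq> H"
    using intervalD[OF assms(1)] assms(2) by (intro cl_subset_flat) auto
  moreover have "cl E r (insert e F) \<in> \<I>"
    using intervalD[OF assms(1)] assms(2) by (intro cl_insert_in_interval) auto
  ultimately show ?thesis using interval_subset_eq assms(1) by blast
qed

lemma finite_interval: "finite \<I>"
proof (rule finite_subset)
  show "\<I> \<subseteq> Pow E" using intervalD(2) by blast
qed (simp add: finite_ground)

lemma card_top_diff: "card (T - F) = (\<Sum>H\<in>\<I>. card (H - F))"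
proof -
  have "T - F = (\<Union>H\<in>\<I>. H - F)"
  proof
    show "T - F \<subseteq> (\<Union>H\<in>\<I>. H - F)"
    proof
      fix e assume e: "e \<in> T - F"
      then have "e \<in> cl E r (insert e F)"
        using subset_cl[of "insert e F"] subset_top top_subset by auto
      then show "e \<in> (\<Union>H\<in>\<I>. H - F)" using cl_insert_in_interval[OF e] e by blast
    qed
    show "(\<Union>H\<in>\<I>. H - F) \<subseteq> T - F" using intervalD(4) by blast
  qed
  moreover have "card (\<Union>H\<in>\<I>. H - F) = (\<Sum>H\<in>\<I>. card (H - F))"
  proof (rule card_UN_disjoint[OF finite_interval])
    show "\<forall>H\<in>\<I>. finite (H - F)"
      using intervalD(2) finite_ground finite_subset by blast
    show "\<forall>H\<in>\<I>. \<forall>G\<in>\<I>. H \<noteq> G \<longrightarrow> (H - F) \<inter> (G - F) = {}"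
      using interval_eq_cl_insert by blast
  qed
  ultimately show ?thesis by simp
qed

lemma card_interval:
  "int (card \<I>) = int (card (T - F)) - (\<Sum>H\<in>\<I>. int (card (H - F)) - 1)"
  by (simp add: card_top_diff sum_subtractf)

section \<open>From flats in the interval to maximal members of \<open>Upsilon\<close>\<close>

lemma Upsilon_iff:
  "Z \<in> Upsilon E r F \<longleftrightarrow> Z \<in> cyclic_flats E r \<and> r Z + card (F - Z) = r F + 1"
  using rank_top by (auto simp: Upsilon_def)

lemma card_diff_ge_2_iff:
  assumes "X \<subseteq> E"
  shows "2 \<le> card (X - F) \<longleftrightarrow> (\<exists>e f. e \<in> X - F \<and> f \<in> X - F \<and> e \<noteq> f)"
proof -
  have "finite (X - F)" using assms finite_ground finite_subset by blast
  then show ?thesis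
    using card_le_Suc0_iff_eq[of "X - F"] by (auto simp: not_less_eq_eq[symmetric] numeral_2_eq_2)
qed

text \<open>A second element \<open>f\<close> of \<open>H - F\<close> already spans \<open>H\<close>
  together with \<open>F\<close>, so removing \<open>e\<close> keeps the rank.\<close>

lemma interval_diff_subset_cyc:
  assumes H: "H \<in> \<I>" and "2 \<le> card (H - F)"
  shows "H - F \<subseteq> cyc r H"
proof
  fix e assume e: "e \<in> H - F"
  obtain f where f: "f \<in> H - F" "f \<noteq> e"
    using assms card_diff_ge_2_iff[OF intervalD(2)[OF H]] by blast
  have fF: "insert f F \<subseteq> E" using f intervalD[OF H] by auto
  have "r H = r (insert f F)"
    using interval_eq_cl_insert[OF H f(1)] rank_cl[OF fF] by simp
  also have "\<dots> \<le> r (H - {e})"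
    using e f intervalD[OF H] by (intro rank_mono) auto
  finally have "r H \<le> r (H - {e})" .
  moreover have "r (H - {e}) \<le> r H" using intervalD[OF H] by (intro rank_mono) auto
  ultimately show "e \<in> cyc r H" using e by (simp add: cyc_def)
qed

text \<open>All coloops of \<open>H\<close> lie in \<open>F\<close>, so \<open>F - cyc r H\<close>
  is exactly the set of coloops, and its size makes up the difference between
  \<open>r (cyc r H)\<close> and \<open>r H\<close>.\<close>

lemma cyc_in_Upsilon:
  assumes H: "H \<in> \<I>" and "2 \<le> card (H - F)"
  shows "cyc r H \<in> Upsilon E r F"
proof -
  have "F - cyc r H = H - cyc r H"
    using interval_diff_subset_cyc[OF assms] intervalD(3)[OF H] by auto
  moreover have "r (cyc r H \<union> (H - cyc r H)) = r (cyc r H) + card (H - cyc r H)"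
    using cyc_subset[of H] by (intro rank_union_coloops[OF intervalD(2)[OF H]]) auto
  moreover have "cyc r H \<union> (H - cyc r H) = H" using cyc_subset[of H] by auto
  ultimately show ?thesis
    using cyc_cyclic_flat[OF intervalD(1)[OF H]] intervalD(5)[OF H] by (simp add: Upsilon_iff)
qed

lemma cyc_diff:
  assumes "H \<in> \<I>" "2 \<le> card (H - F)"
  shows "cyc r H - F = H - F"
  using interval_diff_subset_cyc[OF assms] cyc_subset[of H] by auto

text \<open>The equation defining \<open>Upsilon\<close> bounds \<open>r (Z \<union> F)\<close>
  above by \<open>r F + 1\<close>. An element of \<open>Z\<close> outside the flat \<open>F\<close>
  gives the lower bound; for \<open>Z \<subseteq> F\<close> the closure would be \<open>F\<close>
  itself.\<close>

lemma Upsilon_cl_in_interval: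
  assumes Z: "Z \<in> Upsilon E r F" and "\<not> Z \<subseteq> F"
  shows "cl E r (Z \<union> F) \<in> \<I>"
proof (rule flat_in_interval)
  have ZT: "Z \<subseteq> T" using Z cyclic_flat_subset_top by (simp add: Upsilon_iff)
  then have ZF: "Z \<union> F \<subseteq> E" using subset_top top_subset by auto
  show "cl E r (Z \<union> F) \<in> flats E r" using cl_flat[OF ZF] .
  show "F \<subseteq> cl E r (Z \<union> F)" using subset_cl[OF ZF] by auto
  show "cl E r (Z \<union> F) \<subseteq> T"
    using ZT subset_top by (intro cl_subset_flat top_cyclic_flat_flat) auto
  have "r F < r (Z \<union> F)" using assms ZF by (intro flat_rank_less flat) auto
  moreover have "r (Z \<union> F) \<le> r Z + card (F - Z)" using ZF by (intro rank_union_le) auto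
  ultimately show "r (cl E r (Z \<union> F)) = r F + 1"
    using Z rank_cl[OF ZF] by (simp add: Upsilon_iff)
qed

lemma Upsilon_subset_cyc_cl:
  assumes "Z \<in> Upsilon E r F"
  shows "Z \<subseteq> cyc r (cl E r (Z \<union> F))"
proof -
  have Z: "cyc r Z = Z" "Z \<subseteq> E" using assms by (auto simp: Upsilon_iff cyclic_flats_def flats_def)
  have "Z \<subseteq> cl E r (Z \<union> F)"
    using subset_cl[of "Z \<union> F"] Z subset_top top_subset by auto
  then show ?thesis using cyc_mono[OF _ cl_subset] Z by metis
qed

text \<open>A member \<open>Y\<close> of \<open>Upsilon\<close> above \<open>cyc r H\<close>
  contains \<open>H - F\<close>, so \<open>Y\<close> and \<open>F\<close> span a member of the
  interval that contains \<open>H\<close> and thus equals \<open>H\<close>. Being cyclic,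
  \<open>Y\<close> then lies in \<open>cyc r H\<close>.\<close>

lemma cyc_in_Upsilon_max:
  assumes H: "H \<in> \<I>" and "2 \<le> card (H - F)"
  shows "cyc r H \<in> Upsilon_max E r F"
proof -
  have "Y = cyc r H" if Y: "Y \<in> Upsilon E r F" "cyc r H \<subseteq> Y" for Y
  proof -
    have sub: "H - F \<subseteq> Y" using interval_diff_subset_cyc[OF assms] Y by auto
    then have "cl E r (Y \<union> F) \<in> \<I>"
      using intervalD(3)[OF H] by (intro Upsilon_cl_in_interval Y) auto
    moreover have "H \<subseteq> cl E r (Y \<union> F)"
    proof -
      have "Y \<union> F \<subseteq> E"
        using Y cyclic_flat_subset_top[of Y] subset_top top_subset by (auto simp: Upsilon_iff)
      moreover have "H \<subseteq> Y \<union> F" using sub by auto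
      ultimately show ?thesis using subset_cl by blast
    qed
    ultimately have "H = cl E r (Y \<union> F)" using interval_subset_eq[OF H] by blast
    then show ?thesis using Upsilon_subset_cyc_cl[OF Y(1)] Y(2) by auto
  qed
  then show ?thesis using cyc_in_Upsilon[OF assms] by (auto simp: Upsilon_max_def)
qed

section \<open>Matching the two sums\<close>

lemma bij_betw_cyc:
  "bij_betw (cyc r) {H \<in> \<I>. 2 \<le> card (H - F)} {Z \<in> Upsilon_max E r F. 2 \<le> card (Z - F)}"
  (is "bij_betw _ ?A ?B")
proof (rule bij_betw_imageI)
  show "inj_on (cyc r) ?A"
  proof (rule inj_onI)
    fix H G assume "H \<in> ?A" "G \<in> ?A" "cyc r H = cyc r G"
    \<comment> \<open>The part of \<open>H\<close> outside \<open>F\<close> can be read off from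
      \<open>cyc r H\<close>, and the rest of \<open>H\<close> is \<open>F\<close>.\<close>
    then have "H - F = G - F" using cyc_diff[of H] cyc_diff[of G] by simp
    moreover have "F \<subseteq> H" "F \<subseteq> G" using \<open>H \<in> ?A\<close> \<open>G \<in> ?A\<close> intervalD(3) by blast+
    ultimately show "H = G" by blast
  qed
  show "cyc r ` ?A = ?B"
  proof
    show "cyc r ` ?A \<subseteq> ?B" using cyc_in_Upsilon_max cyc_diff by auto
    show "?B \<subseteq> cyc r ` ?A"
    proof
      fix Z assume "Z \<in> ?B"
      then have Z: "Z \<in> Upsilon E r F" "2 \<le> card (Z - F)"
        and max: "\<And>Y. Y \<in> Upsilon E r F \<Longrightarrow> Z \<subseteq> Y \<Longrightarrow> Y = Z"
        by (auto simp: Upsilon_max_def)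
      \<comment> \<open>The preimage of \<open>Z\<close> is the flat spanned by \<open>Z\<close> and
        \<open>F\<close>: its cyclic part contains \<open>Z\<close> and is in
        \<open>Upsilon\<close>, so maximality of \<open>Z\<close> forces equality.\<close>
      let ?H = "cl E r (Z \<union> F)"
      have "\<not> Z \<subseteq> F"
      proof
        assume "Z \<subseteq> F"
        then have "Z - F = {}" by auto
        then show False using Z(2) by (metis card.empty not_numeral_le_zero)
      qed
      then have H: "?H \<in> \<I>" using Upsilon_cl_in_interval Z by blast
      have sub: "Z \<subseteq> cyc r ?H" using Upsilon_subset_cyc_cl Z by blast
      have "card (Z - F) \<le> card (?H - F)"
        using sub cyc_subset[of ?H] finite_subset[OF cl_subset finite_ground]
        by (intro card_mono) auto
      then have "2 \<le> card (?H - F)" using Z by linarith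
      moreover from this have "cyc r ?H = Z" using cyc_in_Upsilon H sub max by blast
      ultimately show "Z \<in> cyc r ` ?A" using H by blast
    qed
  qed
qed

lemma sum_excess:
  "(\<Sum>Z\<in>Upsilon_max E r F. excess Z F) = (\<Sum>H\<in>\<I>. int (card (H - F)) - 1)"
proof -
  have "Upsilon_max E r F \<subseteq> Pow E"
    by (auto simp: Upsilon_max_def Upsilon_def cyclic_flats_def flats_def)
  then have fin: "finite (Upsilon_max E r F)"
    by (rule finite_subset) (simp add: finite_ground)
  \<comment> \<open>Flats discarded by the bound 2 therefore have exactly one element outside
    \<open>F\<close>, and their summand is 0 rather than -1.\<close>
  have pos: "0 < card (H - F)" if "H \<in> \<I>" for H
    using intervalD[OF that] finite_subset[OF _ finite_ground] by (auto simp: card_gt_0_iff)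
  \<comment> \<open>Members with at most one element outside \<open>F\<close> drop out; for those
    contained in \<open>F\<close> this rests on the cutoff at 0 in \<open>excess\<close>.\<close>
  have "(\<Sum>Z\<in>Upsilon_max E r F. excess Z F)
      = (\<Sum>Z\<in>{Z \<in> Upsilon_max E r F. 2 \<le> card (Z - F)}. excess Z F)"
    by (rule sum.mono_neutral_right[OF fin]) (auto simp: excess_def)
  also have "\<dots> = (\<Sum>H\<in>{H \<in> \<I>. 2 \<le> card (H - F)}. excess (cyc r H) F)"
    by (rule sum.reindex_bij_betw[OF bij_betw_cyc, symmetric])
  also have "\<dots> = (\<Sum>H\<in>{H \<in> \<I>. 2 \<le> card (H - F)}. int (card (H - F)) - 1)"
    by (rule sum.cong) (auto simp: excess_def cyc_diff)
  also have "\<dots> = (\<Sum>H\<in>\<I>. int (card (H - F)) - 1)"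
  proof (rule sum.mono_neutral_left[OF finite_interval])
    show "\<forall>H\<in>\<I> - {H \<in> \<I>. 2 \<le> card (H - F)}. int (card (H - F)) - 1 = 0"
      using pos by fastforce
  qed auto
  finally show ?thesis .
qed

end

theorem theorem6p6:
  fixes E :: "'a set" and r :: "'a set \<Rightarrow> nat" and F :: "'a set"
  assumes "matroid E r"
    and "F \<in> flats E r"
    and "F \<subseteq> top_cyclic_flat E r"
    and "int (r F) = int (r (top_cyclic_flat E r)) - 2"
  shows "int (card (open_flat_interval E r F (top_cyclic_flat E r)))
       = int (card (top_cyclic_flat E r - F)) - (\<Sum>Z\<in>Upsilon_max E r F. excess Z F)"
proof -
  interpret corank_two_flat E r F
    \<comment> \<open>The rank equation over \<open>int\<close> becomes the subtraction-free
      \<open>rank_top\<close> over \<open>nat\<close>.\<close>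
    using assms by (intro corank_two_flat.intro corank_two_flat_axioms.intro) auto
  show ?thesis using card_interval sum_excess by simp
qed

end
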